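(* Let $R$ be a ring and $a\in R$. Then the following are equivalent: (1) $a$ has a generalized Hirano inverse. (2) There exists $p^2=p\in comm^2(a)$ such that $a^2-p\in R^{qnil}$.
   Context: Rings are associative with identity; $U(R)$ is the group of units of $R$. For $a\in R$: $comm(a)=\{x\in R : xa=ax\}$ and $comm^2(a)=\{x\in R : xy=yx \text{ for all } y\in comm(a)\}$. $R^{qnil}=\{a\in R : 1+ax\in U(R)\text{ for every }x\in comm(a)\}$. An element $a\in R$ has a generalized Hirano inverse if there exists $b\in R$ such that $b=bab$, $b\in comm^2(a)$ and $a^2-ab\in R^{qnil}$. *)

theory Defs
  imports "HOL-Algebra.Ring"
begin

(* A ring is associative with identity, not necessarily commutative; the zero ring
   (carrier with one element) is not excluded by the library's locale ring. *)

definition commutant :: "('a, 'b) ring_scheme \<Rightarrow> 'a \<Rightarrow> 'a set" where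
  "commutant R a = {x \<in> carrier R. x \<otimes>\<^bsub>R\<^esub> a = a \<otimes>\<^bsub>R\<^esub> x}"

definition double_commutant :: "('a, 'b) ring_scheme \<Rightarrow> 'a \<Rightarrow> 'a set" where
  "double_commutant R a =
     {x \<in> carrier R. \<forall>y \<in> commutant R a. x \<otimes>\<^bsub>R\<^esub> y = y \<otimes>\<^bsub>R\<^esub> x}"

definition qnil :: "('a, 'b) ring_scheme \<Rightarrow> 'a set" where
  "qnil R =
     {a \<in> carrier R. \<forall>x \<in> commutant R a. \<one>\<^bsub>R\<^esub> \<oplus>\<^bsub>R\<^esub> a \<otimes>\<^bsub>R\<^esub> x \<in> Units R}"

definition has_generalized_Hirano_inverse :: "('a, 'b) ring_scheme \<Rightarrow> 'a \<Rightarrow> bool" where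
  "has_generalized_Hirano_inverse R a \<longleftrightarrow>
     (\<exists>b \<in> carrier R. b = b \<otimes>\<^bsub>R\<^esub> a \<otimes>\<^bsub>R\<^esub> b \<and> b \<in> double_commutant R a \<and>
        a [^]\<^bsub>R\<^esub> (2::nat) \<ominus>\<^bsub>R\<^esub> a \<otimes>\<^bsub>R\<^esub> b \<in> qnil R)"

end

theory Submission
  imports Defs
begin

text \<open>
  If \<open>b\<close> is a generalized Hirano inverse of \<open>a\<close>, then \<open>p = a b\<close> is the required idempotent.
  Conversely, given \<open>p\<close>, the element \<open>u = 1 + (a\<^sup>2 - p)\<close> is a unit and \<open>p u = p a\<^sup>2\<close>. Everything
  in sight lies in the double commutant of \<open>a\<close>, hence commutes, and \<open>b = p a u\<^sup>-\<^sup>1\<close> satisfies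
  \<open>a b = p a\<^sup>2 u\<^sup>-\<^sup>1 = p\<close>.
\<close>

context ring
begin

lemma commutant_self: "a \<in> carrier R \<Longrightarrow> a \<in> commutant R a"
  by (simp add: commutant_def)

lemma double_commutant_self: "a \<in> carrier R \<Longrightarrow> a \<in> double_commutant R a"
  by (auto simp: double_commutant_def commutant_def)

text \<open>Since \<open>a\<close> commutes with itself, \<open>y\<close> commutes with
  \<open>a\<close>, so \<open>y\<close> is one of the elements against which \<open>x\<close> is
  tested. Hence the double commutant is commutative.\<close>

lemma double_commutant_comm:
  assumes "a \<in> carrier R" "x \<in> double_commutant R a" "y \<in> double_commutant R a"
  shows "x \<otimes> y = y \<otimes> x"
proof -
  have "y \<in> commutant R a"
    using assms commutant_self by (auto simp: double_commutant_def commutant_def)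
  then show ?thesis
    using assms(2) by (simp add: double_commutant_def)
qed

text \<open>First of the closure properties making the double commutant a subring that contains the
  inverses of its units; they place \<open>u\<close> and \<open>b\<close> there later.\<close>

lemma double_commutant_one: "\<one> \<in> double_commutant R a"
  by (auto simp: double_commutant_def commutant_def)

lemma double_commutant_mult:
  assumes "x \<in> double_commutant R a" "y \<in> double_commutant R a"
  shows "x \<otimes> y \<in> double_commutant R a"
proof -
  have "x \<otimes> y \<otimes> z = z \<otimes> (x \<otimes> y)" if z: "z \<in> commutant R a" for z
  proof -
    have c: "x \<in> carrier R" "y \<in> carrier R" "z \<in> carrier R"
      using assms z by (auto simp: double_commutant_def commutant_def)
    have "x \<otimes> z = z \<otimes> x" "y \<otimes> z = z \<otimes> y"
      using assms z by (auto simp: double_commutant_def)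
    with c show ?thesis
      by (metis m_assoc)
  qed
  then show ?thesis
    using assms by (auto simp: double_commutant_def)
qed

lemma double_commutant_add:
  assumes "x \<in> double_commutant R a" "y \<in> double_commutant R a"
  shows "x \<oplus> y \<in> double_commutant R a"
  using assms by (auto simp: double_commutant_def commutant_def l_distr r_distr)

lemma double_commutant_minus:
  assumes "x \<in> double_commutant R a" "y \<in> double_commutant R a"
  shows "x \<ominus> y \<in> double_commutant R a"
  using assms
  by (auto simp: double_commutant_def commutant_def minus_eq l_distr r_distr l_minus r_minus)

text \<open>Multiplying \<open>z u = u z\<close> by the inverse of \<open>u\<close> on both sides
  gives the commutation of \<open>z\<close> with that inverse.\<close>

lemma double_commutant_inv:
  assumes "u \<in> double_commutant R a" "u \<in> Units R"
  shows "inv u \<in> double_commutant R a"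
proof -
  have "inv u \<otimes> z = z \<otimes> inv u" if z: "z \<in> commutant R a" for z
  proof -
    have c: "u \<in> carrier R" "inv u \<in> carrier R" "z \<in> carrier R"
      using assms z by (auto simp: commutant_def)
    have "inv u \<otimes> z = inv u \<otimes> (z \<otimes> u) \<otimes> inv u"
      using c assms(2) by (simp add: m_assoc)
    also have "\<dots> = inv u \<otimes> (u \<otimes> z) \<otimes> inv u"
      using assms(1) z by (simp add: double_commutant_def)
    also have "\<dots> = z \<otimes> inv u"
      using c assms(2) by (simp add: m_assoc [symmetric])
    finally show ?thesis .
  qed
  then show ?thesis
    using assms by (auto simp: double_commutant_def)
qed

text \<open>The identity commutes with \<open>w\<close>, so it may be taken as the test element
  \<open>x\<close>.\<close>

lemma qnil_one_plus_Units:
  assumes "w \<in> qnil R"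
  shows "\<one> \<oplus> w \<in> Units R"
proof -
  have w: "w \<in> carrier R"
    using assms by (simp add: qnil_def)
  then have "\<one> \<in> commutant R w"
    by (simp add: commutant_def)
  then have "\<one> \<oplus> w \<otimes> \<one> \<in> Units R"
    using assms unfolding qnil_def by blast
  with w show ?thesis
    by simp
qed

end

theorem theorem2p5:
  fixes R :: "('a, 'b) ring_scheme" and a :: 'a
  assumes "ring R" and "a \<in> carrier R"
  shows "has_generalized_Hirano_inverse R a \<longleftrightarrow>
    (\<exists>p \<in> carrier R. p [^]\<^bsub>R\<^esub> (2::nat) = p \<and> p \<in> double_commutant R a \<and>
       a [^]\<^bsub>R\<^esub> (2::nat) \<ominus>\<^bsub>R\<^esub> p \<in> qnil R)"
proof -
  interpret ring R by fact
  note a = \<open>a \<in> carrier R\<close>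
  note a_dc = double_commutant_self [OF a]
  have square: "x [^]\<^bsub>R\<^esub> (2::nat) = x \<otimes>\<^bsub>R\<^esub> x" if "x \<in> carrier R" for x
    using that by (simp add: numeral_2_eq_2)
  show ?thesis
  proof
    assume "has_generalized_Hirano_inverse R a"
    then obtain b where b: "b \<in> carrier R" "b = b \<otimes>\<^bsub>R\<^esub> a \<otimes>\<^bsub>R\<^esub> b" "b \<in> double_commutant R a"
      "a [^]\<^bsub>R\<^esub> (2::nat) \<ominus>\<^bsub>R\<^esub> a \<otimes>\<^bsub>R\<^esub> b \<in> qnil R"
      by (auto simp: has_generalized_Hirano_inverse_def)
    \<comment> \<open>Regrouping \<open>(a b)(a b)\<close> exposes the factor \<open>b a b\<close>,
      which collapses to \<open>b\<close>.\<close>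
    have "(a \<otimes>\<^bsub>R\<^esub> b) [^]\<^bsub>R\<^esub> (2::nat) = a \<otimes>\<^bsub>R\<^esub> (b \<otimes>\<^bsub>R\<^esub> a \<otimes>\<^bsub>R\<^esub> b)"
      using a b(1) by (simp add: square m_assoc)
    also have "\<dots> = a \<otimes>\<^bsub>R\<^esub> b"
      using b(2) by simp
    finally show "\<exists>p \<in> carrier R. p [^]\<^bsub>R\<^esub> (2::nat) = p \<and> p \<in> double_commutant R a \<and>
        a [^]\<^bsub>R\<^esub> (2::nat) \<ominus>\<^bsub>R\<^esub> p \<in> qnil R"
      using a b double_commutant_mult [OF a_dc b(3)] by blast
  next
    assume "\<exists>p \<in> carrier R. p [^]\<^bsub>R\<^esub> (2::nat) = p \<and> p \<in> double_commutant R a \<and>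
        a [^]\<^bsub>R\<^esub> (2::nat) \<ominus>\<^bsub>R\<^esub> p \<in> qnil R"
    then obtain p where p: "p \<in> carrier R" and pp: "p \<otimes>\<^bsub>R\<^esub> p = p"
      and p_dc: "p \<in> double_commutant R a" and w: "a [^]\<^bsub>R\<^esub> (2::nat) \<ominus>\<^bsub>R\<^esub> p \<in> qnil R"
      by (auto simp: square)
    define u where "u = \<one>\<^bsub>R\<^esub> \<oplus>\<^bsub>R\<^esub> (a \<otimes>\<^bsub>R\<^esub> a \<ominus>\<^bsub>R\<^esub> p)"
    have u_unit: "u \<in> Units R"
      using qnil_one_plus_Units [OF w] a by (simp add: u_def square)
    have u_dc: "u \<in> double_commutant R a"
      unfolding u_def
      by (intro double_commutant_add double_commutant_one double_commutant_minus
          double_commutant_mult a_dc p_dc)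
    have c: "u \<in> carrier R" "inv\<^bsub>R\<^esub> u \<in> carrier R"
      using u_unit by auto
    have pa: "p \<otimes>\<^bsub>R\<^esub> a = a \<otimes>\<^bsub>R\<^esub> p"
      using double_commutant_comm [OF a p_dc a_dc] .
    have pu: "p \<otimes>\<^bsub>R\<^esub> u = p \<otimes>\<^bsub>R\<^esub> (a \<otimes>\<^bsub>R\<^esub> a)"
    proof -
      \<comment> \<open>Idempotence turns \<open>p (- p)\<close> into \<open>- p\<close>, which
        cancels the \<open>p\<close> coming from the summand 1.\<close>
      have "p \<otimes>\<^bsub>R\<^esub> u = p \<oplus>\<^bsub>R\<^esub> (p \<otimes>\<^bsub>R\<^esub> (a \<otimes>\<^bsub>R\<^esub> a) \<ominus>\<^bsub>R\<^esub> p)"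
        using a p pp by (simp add: u_def minus_eq r_distr r_minus)
      also have "\<dots> = p \<otimes>\<^bsub>R\<^esub> (a \<otimes>\<^bsub>R\<^esub> a)"
        using a p by (simp add: minus_eq a_comm [of _ "\<ominus>\<^bsub>R\<^esub> p"] r_neg2)
      finally show ?thesis .
    qed
    \<comment> \<open>By \<open>pu\<close>, multiplication by \<open>u\<close> agrees with
      multiplication by \<open>a a\<close> after the factor \<open>p\<close>. So \<open>a\<close>
      times the inverse of \<open>u\<close> serves as an inverse of \<open>a\<close> there, and
      \<open>p\<close> cuts away the rest.\<close>
    define b where "b = p \<otimes>\<^bsub>R\<^esub> a \<otimes>\<^bsub>R\<^esub> inv\<^bsub>R\<^esub> u"
    have b: "b \<in> carrier R"
      using a p c by (simp add: b_def)
    have b_dc: "b \<in> double_commutant R a"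
      unfolding b_def
      by (intro double_commutant_mult double_commutant_inv p_dc a_dc u_dc u_unit)
    have ab: "a \<otimes>\<^bsub>R\<^esub> b = p"
    proof -
      have "a \<otimes>\<^bsub>R\<^esub> b = (a \<otimes>\<^bsub>R\<^esub> p) \<otimes>\<^bsub>R\<^esub> a \<otimes>\<^bsub>R\<^esub> inv\<^bsub>R\<^esub> u"
        using a p c by (simp add: b_def m_assoc)
      \<comment> \<open>Moving \<open>p\<close> to the left of \<open>a\<close> produces
        \<open>p (a a)\<close>, which \<open>pu\<close> read backwards replaces by
        \<open>p u\<close>, so that \<open>u\<close> cancels its inverse.\<close>
      also have "\<dots> = p \<otimes>\<^bsub>R\<^esub> (a \<otimes>\<^bsub>R\<^esub> a) \<otimes>\<^bsub>R\<^esub> inv\<^bsub>R\<^esub> u"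
        using a p c by (simp add: pa [symmetric] m_assoc)
      also have "\<dots> = p"
        using p c u_unit by (simp add: pu [symmetric] m_assoc)
      finally show ?thesis .
    qed
    \<comment> \<open>As \<open>b a = a b = p\<close>, the identity \<open>b = b a b\<close> reduces
      to \<open>p b = b\<close>, which holds because \<open>b\<close> starts with the idempotent
      \<open>p\<close>.\<close>
    have "b \<otimes>\<^bsub>R\<^esub> a \<otimes>\<^bsub>R\<^esub> b = p \<otimes>\<^bsub>R\<^esub> b"
      using double_commutant_comm [OF a b_dc a_dc] ab by simp
    also have "\<dots> = (p \<otimes>\<^bsub>R\<^esub> p) \<otimes>\<^bsub>R\<^esub> a \<otimes>\<^bsub>R\<^esub> inv\<^bsub>R\<^esub> u"
      using a p c by (simp add: b_def m_assoc)
    also have "\<dots> = b"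
      by (simp add: pp b_def)
    \<comment> \<open>With \<open>a b = p\<close>, the quasinilpotence condition on \<open>b\<close>
      is exactly the hypothesis \<open>w\<close>.\<close>
    finally show "has_generalized_Hirano_inverse R a"
      unfolding has_generalized_Hirano_inverse_def using b b_dc ab w by metis
  qed
qed

end
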